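(* For any integer $n>1$, $\kappa(\mathcal{G}(\mathbb{Z}_n)) = \lambda_{n-1}(\mathcal{G}(\mathbb{Z}_n))$ if and only if $n$ is a product of two distinct primes.
   Context: $\mathbb{Z}_n$ is the additive cyclic group of order $n$. The power graph $\mathcal{G}(G)$ of a group $G$ has vertex set $G$, distinct $u,v$ adjacent iff one is a positive power of the other. $\kappa(\Gamma)$ is the vertex connectivity (minimum number of vertices whose removal leaves a disconnected or one-vertex graph). For a graph on $n$ vertices, $\lambda_{n-1}(\Gamma)$ is the second smallest eigenvalue of the Laplacian matrix $L(\Gamma)=D(\Gamma)-A(\Gamma)$ (the algebraic connectivity). *)

theory Defs
  imports
    "HOL-Algebra.Elementary_Groups"
    "Graph_Theory.Graph_Theory"
    "Jordan_Normal_Form.Char_Poly"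
begin

text \<open>
  As usual in \<^theory>\<open>Graph_Theory.Graph_Theory\<close>, an undirected simple graph is a symmetric loop-free
  digraph without parallel arcs, i.e. every edge is represented by its two orientations.
\<close>

definition power_graph :: "('a, 'b) monoid_scheme \<Rightarrow> 'a pair_pre_digraph" where
  "power_graph G =
     \<lparr> pverts = carrier G,
       parcs = {(u, v). u \<in> carrier G \<and> v \<in> carrier G \<and> u \<noteq> v \<and>
                  (\<exists>m::nat. m > 0 \<and> (v = u [^]\<^bsub>G\<^esub> m \<or> u = v [^]\<^bsub>G\<^esub> m))} \<rparr>"

lemma pair_graph_power_graph:
  assumes "finite (carrier G)"
  shows "pair_graph (power_graph G)"
proof -
  have "parcs (power_graph G) \<subseteq> carrier G \<times> carrier G"
    by (auto simp: power_graph_def)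
  then have "finite (parcs (power_graph G))"
    using assms by (meson finite_SigmaI finite_subset)
  then show ?thesis
    using assms by unfold_locales (auto simp: power_graph_def symmetric_def sym_def)
qed

text \<open>
  Intended for finite nonempty graphs. The library regards the empty graph as not connected, so
  removing all vertices also satisfies the condition below. This does not affect the minimum:
  removing all vertices but one is always possible and needs fewer vertices.
\<close>

definition vertex_connectivity :: "('a, 'b) pre_digraph \<Rightarrow> nat" where
  "vertex_connectivity \<Gamma> =
     (LEAST k. \<exists>S \<subseteq> verts \<Gamma>. finite S \<and> card S = k \<and>
        (\<not> connected (\<Gamma> \<restriction> (verts \<Gamma> - S)) \<or> card (verts \<Gamma> - S) = 1))"

text \<open>
  Rows and columns are indexed by the vertices in increasing order. A different enumeration
  conjugates the matrices below by a permutation matrix and leaves the spectrum unchanged.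
\<close>

definition degree_matrix :: "('a::linorder, 'b) pre_digraph \<Rightarrow> real mat" where
  "degree_matrix \<Gamma> = (let vs = sorted_list_of_set (verts \<Gamma>); n = card (verts \<Gamma>) in
     mat n n (\<lambda>(i, j). if i = j then real (out_degree \<Gamma> (vs ! i)) else 0))"

definition adjacency_matrix :: "('a::linorder, 'b) pre_digraph \<Rightarrow> real mat" where
  "adjacency_matrix \<Gamma> = (let vs = sorted_list_of_set (verts \<Gamma>); n = card (verts \<Gamma>) in
     mat n n (\<lambda>(i, j). if vs ! i \<rightarrow>\<^bsub>\<Gamma>\<^esub> vs ! j then 1 else 0))"

definition laplacian_matrix :: "('a::linorder, 'b) pre_digraph \<Rightarrow> real mat" where
  "laplacian_matrix \<Gamma> = degree_matrix \<Gamma> - adjacency_matrix \<Gamma>"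

text \<open>
  The eigenvalues are listed with multiplicity in decreasing order and numbered from 1, so that the
  last one, with index the number of vertices, is 0. As the Laplacian matrix of an undirected graph
  is real and symmetric, its real characteristic polynomial splits and the list is complete.
\<close>

definition laplacian_eigenvalue :: "('a::linorder, 'b) pre_digraph \<Rightarrow> nat \<Rightarrow> real" where
  "laplacian_eigenvalue \<Gamma> k =
     rev (sorted_list_of_multiset (proots (char_poly (laplacian_matrix \<Gamma>)))) ! (k - 1)"

end

theory Submission
  imports Defs "Jordan_Normal_Form.Schur_Decomposition" "HOL-Number_Theory.Cong"
begin

text \<open>
  Let a minimum cut \<open>S\<close> split the remaining vertices into parts \<open>A\<close> and \<open>B\<close> without edges between them.
  Evaluating the Laplacian form at the function with values \<open>|B|\<close> on \<open>A\<close>, \<open>-|A|\<close> on \<open>B\<close> and \<open>0\<close> on \<open>S\<close>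
  bounds the algebraic connectivity by \<open>|S|\<close>, strictly unless every vertex of \<open>S\<close> is adjacent to all
  of \<open>A \<union> B\<close>. In the other direction, a set of \<open>m\<close> vertices adjacent to everything forces algebraic
  connectivity at least \<open>m\<close>; in particular a complete graph has it above the vertex connectivity.

  In the power graph of the cyclic group, \<open>u\<close> and \<open>v\<close> are adjacent iff their labels \<open>gcd(u, n)\<close>
  and \<open>gcd(v, n)\<close> are comparable under divisibility. If equality holds, \<open>A \<union> B\<close> is closed under incomparability, hence
  contains every vertex whose label is a proper divisor of \<open>n\<close>. For \<open>a\<close> in \<open>A\<close> and \<open>b\<close> in \<open>B\<close>, a vertex
  labelled by the lcm or the gcd of their labels would connect them, so the lcm is \<open>n\<close> and the gcd is \<open>1\<close>.
  Then there is only one label on each side, and both are prime. Conversely, for \<open>n = pq\<close> the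
  vertices labelled \<open>1\<close> and \<open>n\<close> dominate the graph and form a cut, so both bounds coincide.
\<close>

section \<open>Orthogonal diagonalization of real symmetric matrices\<close>

text \<open>Supplies the change of basis for one deflation step. Gram-Schmidt keeps the first vector
  of the completed basis, so after normalisation the first column is still a multiple of
  \<open>v\<close>.\<close>

lemma orthonormal_completion:
  fixes v :: "real vec"
  assumes v: "v \<in> carrier_vec n" and v0: "v \<noteq> 0\<^sub>v n"
  obtains W c where "W \<in> carrier_mat n n" "W\<^sup>T * W = 1\<^sub>m n" "col W 0 = c \<cdot>\<^sub>v v"
proof -
  interpret cof_vec_space n "TYPE(real)" .
  define b where "b = basis_completion v"
  define ws where "ws = gram_schmidt n b"
  have n: "n \<noteq> 0"
    using v v0 by (auto intro!: eq_vecI)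
  note bc = basis_completion[OF v v0, folded b_def]
  have b_ne: "b \<noteq> []"
    using bc(6) n by auto
  then obtain vs where bv: "b = v # vs"
    using bc(7) by (cases b) auto
  have ws: "set ws \<subseteq> carrier_vec n" "corthogonal ws" "length ws = n"
    using gram_schmidt_result[OF bc(2,4,5) refl, folded ws_def] bc(6) by auto
  have hdws: "ws ! 0 = v"
    using gram_schmidt_hd[OF v, of vs, folded bv ws_def] ws(3) n by (auto simp: hd_conv_nth)
  have carr: "ws ! i \<in> carrier_vec n" if "i < n" for i
    using that ws by auto
  have orth: "ws ! i \<bullet> ws ! j = 0 \<longleftrightarrow> i \<noteq> j" if "i < n" "j < n" for i j
    using corthogonalD[OF ws(2), of i j] that ws(3) by simp
  define r where "r i = 1 / sqrt (ws ! i \<bullet> ws ! i)" for i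
  define W where "W = mat_of_cols n (map (\<lambda>i. r i \<cdot>\<^sub>v ws ! i) [0..<n])"
  have W: "W \<in> carrier_mat n n"
    unfolding W_def by auto
  have colW: "col W i = r i \<cdot>\<^sub>v ws ! i" if "i < n" for i
    unfolding W_def using that carr[OF that] by (subst col_mat_of_cols) auto
  have "W\<^sup>T * W = 1\<^sub>m n"
  proof (rule eq_matI)
    fix i j assume "i < dim_row (1\<^sub>m n :: real mat)" "j < dim_col (1\<^sub>m n :: real mat)"
    then have ij: "i < n" "j < n" by auto
    have pos: "ws ! i \<bullet> ws ! i > 0"
      using orth[OF ij(1) ij(1)] conjugate_square_ge_0_vec[of "ws ! i"] by simp
    have "(W\<^sup>T * W) $$ (i, j) = col W i \<bullet> col W j"
      using ij W by simp
    also have "\<dots> = r i * (r j * (ws ! i \<bullet> ws ! j))"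
      using colW ij carr[OF ij(1)] carr[OF ij(2)] by simp
    also have "\<dots> = 1\<^sub>m n $$ (i, j)"
      using ij orth[OF ij] pos by (auto simp: r_def field_simps)
    finally show "(W\<^sup>T * W) $$ (i, j) = 1\<^sub>m n $$ (i, j)" .
  qed (use W in auto)
  moreover have "col W 0 = r 0 \<cdot>\<^sub>v v"
    using colW[of 0] n hdws by simp
  ultimately show ?thesis
    using that W by blast
qed

text \<open>Used after splitting off one eigenvalue: the remaining block inherits symmetry, so the
  induction can continue, and a vanishing first column forces a vanishing first row.\<close>

lemma transpose_four_block_mat_sym:
  assumes "four_block_mat A1 A2 A0 A3 = (four_block_mat A1 A2 A0 A3)\<^sup>T"
    and "A1 \<in> carrier_mat k k" "A2 \<in> carrier_mat k m" "A0 \<in> carrier_mat m k" "A3 \<in> carrier_mat m m"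
  shows "A3\<^sup>T = A3" "A2 = A0\<^sup>T"
proof -
  have eq: "four_block_mat A1 A2 A0 A3 $$ (i, j) = four_block_mat A1 A2 A0 A3 $$ (j, i)"
    if "i < k + m" "j < k + m" for i j
    using that assms(2-) arg_cong[OF assms(1), of "\<lambda>M. M $$ (i, j)"] by simp
  show "A3\<^sup>T = A3"
  proof (rule eq_matI)
    fix i j assume "i < dim_row A3" "j < dim_col A3"
    then show "A3\<^sup>T $$ (i, j) = A3 $$ (i, j)"
      using eq[of "k + i" "k + j"] assms(2-) by auto
  qed (use assms in auto)
  show "A2 = A0\<^sup>T"
  proof (rule eq_matI)
    fix i j assume "i < dim_row (A0\<^sup>T)" "j < dim_col (A0\<^sup>T)"
    then show "A2 $$ (i, j) = A0\<^sup>T $$ (i, j)"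
      using eq[of i "k + j"] assms(2-) by auto
  qed (use assms in auto)
qed

text \<open>Induction by deflation: an eigenvector for the head of \<open>es\<close> becomes the
  first basis vector, and the tail is realised on the complementary block. The diagonal follows the
  order of \<open>es\<close>, which later allows a sorted version.\<close>

lemma orthogonal_diagonalization:
  fixes A :: "real mat"
  assumes "A \<in> carrier_mat n n" "A\<^sup>T = A" "char_poly A = (\<Prod>e\<leftarrow>es. [:- e, 1:])"
  shows "\<exists>U \<in> carrier_mat n n. U\<^sup>T * U = 1\<^sub>m n \<and> U\<^sup>T * A * U = mat_diag n ((!) es)"
  using assms
proof (induction es arbitrary: n A)
  case Nil
  then have "n = 0"
    using degree_monic_char_poly[of A n] by auto
  then show ?case
    using Nil.prems(1) by (intro bexI[of _ "1\<^sub>m n"]) (auto simp: mat_diag_def)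
next
  case (Cons e es)
  note A = Cons.prems(1)
  have e: "eigenvalue A e"
    unfolding eigenvalue_root_char_poly[OF A] Cons.prems(3) by simp
  obtain v where v: "v \<in> carrier_vec n" "v \<noteq> 0\<^sub>v n" "A *\<^sub>v v = e \<cdot>\<^sub>v v"
    using find_eigenvector[OF A e] A unfolding eigenvector_def by auto
  have "n \<noteq> 0"
    using v(1,2) by (auto intro!: eq_vecI)
  then obtain m where n: "n = 1 + m"
    by (cases n) auto
  obtain W c where W: "W \<in> carrier_mat n n" "W\<^sup>T * W = 1\<^sub>m n" and W0: "col W 0 = c \<cdot>\<^sub>v v"
    using orthonormal_completion[OF v(1,2)] by blast
  have WW: "W * W\<^sup>T = 1\<^sub>m n"
    using mat_mult_left_right_inverse[of "W\<^sup>T" n W] W by simp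
  define A' where "A' = W\<^sup>T * A * W"
  have A': "A' \<in> carrier_mat n n"
    using W A unfolding A'_def by auto
  have symA': "A'\<^sup>T = A'"
    unfolding A'_def using A W(1) Cons.prems(2)
    by (simp add: transpose_mult[of _ n n _ n] assoc_mult_mat[of _ n n _ n _ n])
  have "similar_mat_wit A' A (W\<^sup>T) W"
    using W WW A A' by (intro similar_mat_witI[of _ _ n]) (auto simp: A'_def)
  then have "char_poly A' = char_poly A"
    by (intro char_poly_similar) (auto simp: similar_mat_def)
  then have cp: "char_poly A' = [:- e, 1:] * (\<Prod>e\<leftarrow>es. [:- e, 1:])"
    using Cons.prems(3) by simp
  \<comment> \<open>Column 0 of \<open>W\<close> is a multiple of the eigenvector \<open>v\<close>,
    and the columns of \<open>W\<close> are orthonormal.\<close>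
  have A'0: "A' $$ (i, 0) = (if i = 0 then e else 0)" if i: "i < n" for i
  proof -
    have "A' $$ (i, 0) = col W i \<bullet> (A *\<^sub>v col W 0)"
      unfolding A'_def using i n A W(1)
      by (simp add: assoc_mult_mat[of _ n n _ n _ n] mult_mat_vec_def)
    also have "A *\<^sub>v col W 0 = e \<cdot>\<^sub>v col W 0"
      unfolding W0 using v(1,3) A by (simp add: mult_mat_vec smult_smult_assoc mult.commute)
    also have "col W i \<bullet> (e \<cdot>\<^sub>v col W 0) = e * (W\<^sup>T * W) $$ (i, 0)"
      using i n W(1) by simp
    also have "\<dots> = (if i = 0 then e else 0)"
      unfolding W(2) using i n by simp
    finally show ?thesis .
  qed
  obtain A1 A2 A0 A3 where split: "split_block A' 1 1 = (A1, A2, A0, A3)"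
    by (cases "split_block A' 1 1") auto
  have blk: "A1 \<in> carrier_mat 1 1" "A2 \<in> carrier_mat 1 m" "A0 \<in> carrier_mat m 1"
    "A3 \<in> carrier_mat m m" "A' = four_block_mat A1 A2 A0 A3"
    using split_block[OF split, of m m] A' n by auto
  have A1: "A1 = mat 1 1 (\<lambda>_. e)"
    using blk arg_cong[OF blk(5), of "\<lambda>M. M $$ (0, 0)"] A'0[of 0] n by (intro eq_matI) auto
  have A0: "A0 = 0\<^sub>m m 1"
  proof (rule eq_matI)
    fix i j assume "i < dim_row (0\<^sub>m m 1 :: real mat)" "j < dim_col (0\<^sub>m m 1 :: real mat)"
    then show "A0 $$ (i, j) = 0\<^sub>m m 1 $$ (i, j)"
      using blk(1-4) arg_cong[OF blk(5), of "\<lambda>M. M $$ (Suc i, 0)"] A'0[of "Suc i"] n by auto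
  qed (use blk in auto)
  note sym3 = transpose_four_block_mat_sym[OF _ blk(1-4), folded blk(5), OF symA'[symmetric]]
  have A2: "A2 = 0\<^sub>m 1 m"
    using sym3(2) A0 by simp
  have "char_poly A' = char_poly A1 * char_poly A3"
    unfolding blk(5) A0 by (rule char_poly_four_block_zeros_col[OF blk(1,2,4)])
  also have "char_poly A1 = [:- e, 1:]"
    by (simp add: A1 char_poly_defs det_def sign_def)
  finally have "char_poly A3 = (\<Prod>e\<leftarrow>es. [:- e, 1:])"
    using cp by (metis mult_cancel_left pCons_eq_0_iff zero_neq_one)
  from Cons.IH[OF blk(4) sym3(1) this] obtain V where
    V: "V \<in> carrier_mat m m" "V\<^sup>T * V = 1\<^sub>m m" "V\<^sup>T * A3 * V = mat_diag m ((!) es)"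
    by blast
  \<comment> \<open>\<open>V\<close> is extended by the identity on the coordinate already split
    off.\<close>
  define Z where "Z = four_block_mat (1\<^sub>m 1) (0\<^sub>m 1 m) (0\<^sub>m m 1) V"
  have Z: "Z \<in> carrier_mat n n"
    unfolding Z_def n using V(1) by auto
  have ZT: "Z\<^sup>T = four_block_mat (1\<^sub>m 1) (0\<^sub>m 1 m) (0\<^sub>m m 1) (V\<^sup>T)"
    unfolding Z_def using V(1) by (subst transpose_four_block_mat[of _ 1 1 _ m _ m]) auto
  have "Z\<^sup>T * Z = four_block_mat (1\<^sub>m 1) (0\<^sub>m 1 m) (0\<^sub>m m 1) (V\<^sup>T * V)"
    unfolding ZT unfolding Z_def using V(1)
    by (subst mult_four_block_mat[of _ 1 1 _ m _ m _ _ 1 _ m]) auto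
  also have "\<dots> = 1\<^sub>m n"
    unfolding V(2) n by (rule four_block_one_mat)
  finally have ZZ: "Z\<^sup>T * Z = 1\<^sub>m n" .
  have "Z\<^sup>T * A' = four_block_mat A1 (0\<^sub>m 1 m) (0\<^sub>m m 1) (V\<^sup>T * A3)"
    unfolding ZT blk(5) A0 A2 using V(1) blk(1,4)
    by (subst mult_four_block_mat[of _ 1 1 _ m _ m _ _ 1 _ m]) auto
  then have "Z\<^sup>T * A' * Z = four_block_mat A1 (0\<^sub>m 1 m) (0\<^sub>m m 1) (V\<^sup>T * A3 * V)"
    unfolding Z_def using V(1) blk(1,4)
    by (simp, subst mult_four_block_mat[of _ 1 1 _ m _ m _ _ 1 _ m]) auto
  also have "\<dots> = mat_diag n ((!) (e # es))"
    unfolding V(3) A1 n by (rule eq_matI) (auto simp: mat_diag_def nth_Cons')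
  finally have ZAZ: "Z\<^sup>T * A' * Z = mat_diag n ((!) (e # es))" .
  show ?case
  proof (intro bexI[of _ "W * Z"] conjI)
    have "(W * Z)\<^sup>T * (W * Z) = Z\<^sup>T * (W\<^sup>T * W) * Z"
      using W(1) Z by (simp add: transpose_mult[of _ n n _ n] assoc_mult_mat[of _ n n _ n _ n])
    then show "(W * Z)\<^sup>T * (W * Z) = 1\<^sub>m n"
      using W Z ZZ by simp
    have "(W * Z)\<^sup>T * A * (W * Z) = Z\<^sup>T * A' * Z"
      unfolding A'_def using W(1) Z A
      by (simp add: transpose_mult[of _ n n _ n] assoc_mult_mat[of _ n n _ n _ n])
    then show "(W * Z)\<^sup>T * A * (W * Z) = mat_diag n ((!) (e # es))"
      using ZAZ by simp
  qed (use W Z in auto)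
qed

text \<open>The Hermitian argument: moving the matrix across the inner product of an eigenvector
  with itself replaces \<open>z\<close> by its conjugate.\<close>

lemma symmetric_complex_eigenvalue_real:
  fixes A :: "real mat"
  assumes A: "A \<in> carrier_mat n n" and sym: "A\<^sup>T = A"
    and ev: "eigenvalue (map_mat complex_of_real A) z"
  shows "z \<in> \<real>"
proof -
  let ?A = "map_mat complex_of_real A"
  have cA: "?A \<in> carrier_mat n n" using A by simp
  obtain v where v: "v \<in> carrier_vec n" "v \<noteq> 0\<^sub>v n" "?A *\<^sub>v v = z \<cdot>\<^sub>v v"
    using find_eigenvector[OF cA ev] A unfolding eigenvector_def by auto
  have conjA: "conjugate (?A *\<^sub>v v) = ?A *\<^sub>v conjugate v"
    using A v(1) by (intro eq_vecI) (auto simp: scalar_prod_def sum_conjugate conjugate_dist_mul)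
  have "(?A *\<^sub>v v) \<bullet> conjugate v = v \<bullet> (?A *\<^sub>v conjugate v)"
  proof -
    have "?A\<^sup>T = ?A"
      using sym by (metis map_mat_transpose)
    then show ?thesis
      using transpose_vec_mult_scalar[OF cA, of "conjugate v" v] v(1) cA by simp
  qed
  then have "z * (v \<bullet>c v) = cnj z * (v \<bullet>c v)"
    unfolding conjA[symmetric] v(3) using v(1) by (simp add: conjugate_smult_vec)
  moreover have "v \<bullet>c v \<noteq> 0"
    using v conjugate_square_eq_0_vec by blast
  ultimately have "cnj z = z" by simp
  then show ?thesis by (simp add: complex_is_Real_iff complex_eq_iff)
qed

text \<open>Over the complex numbers the polynomial splits and all its roots are real; as real
  polynomials embed injectively into complex ones, the factorization descends.\<close>

lemma symmetric_char_poly_splits: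
  fixes A :: "real mat"
  assumes A: "A \<in> carrier_mat n n" and sym: "A\<^sup>T = A"
  shows "\<exists>es. char_poly A = (\<Prod>e\<leftarrow>es. [:- e, 1:])"
proof -
  let ?A = "map_mat complex_of_real A"
  have cA: "?A \<in> carrier_mat n n" using A by simp
  obtain as where as: "char_poly ?A = (\<Prod>a\<leftarrow>as. [:- a, 1:])"
    using char_poly_factorized[OF cA] by blast
  have "a \<in> \<real>" if "a \<in> set as" for a
  proof (rule symmetric_complex_eigenvalue_real[OF A sym])
    show "eigenvalue ?A a"
      unfolding eigenvalue_root_char_poly[OF cA] as using that
      by (auto simp: poly_prod_list prod_list_zero_iff)
  qed
  then have as': "as = map (complex_of_real \<circ> Re) as"
    by (intro map_idI[symmetric]) auto
  interpret ph: map_poly_inj_idom_hom complex_of_real ..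
  have "map_poly complex_of_real (char_poly A) = (\<Prod>a\<leftarrow>as. [:- a, 1:])"
    using of_real_hom.char_poly_hom[OF A] as by metis
  also have "\<dots> = map_poly complex_of_real (\<Prod>e\<leftarrow>map Re as. [:- e, 1:])"
    by (subst as') (simp add: ph.hom_prod_list o_def)
  finally show ?thesis
    by (intro exI[of _ "map Re as"]) (simp add: ph.eq_iff)
qed

section \<open>The second smallest eigenvalue\<close>

definition eigenvalue_list :: "real mat \<Rightarrow> real list" where
  "eigenvalue_list A = sorted_list_of_multiset (proots (char_poly A))"

lemma proots_prod_list_linear:
  "proots (\<Prod>e\<leftarrow>es. [:- e, 1:]) = mset (es :: 'a :: idom list)"
proof (induction es)
  case (Cons e es)
  have "(\<Prod>e\<leftarrow>es. [:- e, 1:]) \<noteq> 0"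
    by (auto simp: prod_list_zero_iff)
  then show ?case
    using Cons.IH by (simp add: proots_mult del: mult_pCons_left)
qed simp

lemma orthogonal_diagonalization_sorted:
  fixes A :: "real mat"
  assumes A: "A \<in> carrier_mat n n" and sym: "A\<^sup>T = A"
  obtains U where "U \<in> carrier_mat n n" "U\<^sup>T * U = 1\<^sub>m n"
    "U\<^sup>T * A * U = mat_diag n ((!) (eigenvalue_list A))"
    "length (eigenvalue_list A) = n" "sorted (eigenvalue_list A)"
proof -
  obtain es where es: "char_poly A = (\<Prod>e\<leftarrow>es. [:- e, 1:])"
    using symmetric_char_poly_splits[OF A sym] by blast
  have "eigenvalue_list A = sort es"
    by (simp add: eigenvalue_list_def es proots_prod_list_linear)
  \<comment> \<open>The factors commute, so the diagonalization may be run on the sorted list of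
    roots.\<close>
  moreover have "char_poly A = (\<Prod>e\<leftarrow>sort es. [:- e, 1:])"
    unfolding es by (metis (no_types, lifting) mset_map mset_sort prod_mset_prod_list)
  moreover have "length es = n"
    using degree_monic_char_poly[OF A] es by (simp add: degree_linear_factors)
  ultimately show ?thesis
    using orthogonal_diagonalization[OF A sym, of "sort es"] that by auto
qed

text \<open>In the coordinates \<open>U\<^sup>T *\<^sub>v z\<close> of the orthonormal eigenbasis
  both forms are diagonal.\<close>

lemma orthogonal_quadratic_forms:
  fixes A U :: "real mat"
  assumes A: "A \<in> carrier_mat n n" and U: "U \<in> carrier_mat n n" "U\<^sup>T * U = 1\<^sub>m n"
    and D: "U\<^sup>T * A * U = mat_diag n d" and z: "z \<in> carrier_vec n"
  shows "z \<bullet> (A *\<^sub>v z) = (\<Sum>i<n. d i * (col U i \<bullet> z)\<^sup>2)"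
    and "z \<bullet> z = (\<Sum>i<n. (col U i \<bullet> z)\<^sup>2)"
proof -
  define c where "c = U\<^sup>T *\<^sub>v z"
  have c: "c \<in> carrier_vec n" "\<And>i. i < n \<Longrightarrow> c $ i = col U i \<bullet> z"
    using U z by (auto simp: c_def)
  have UU: "U * U\<^sup>T = 1\<^sub>m n"
    using mat_mult_left_right_inverse[of "U\<^sup>T" n U] U by simp
  have UUw: "U *\<^sub>v (U\<^sup>T *\<^sub>v w) = w" if "w \<in> carrier_vec n" for w
    using U(1) UU that assoc_mult_mat_vec[of U n n "U\<^sup>T" n w] by simp
  then have zc: "z = U *\<^sub>v c"
    unfolding c_def using z by simp
  have adj: "z \<bullet> (U *\<^sub>v w) = c \<bullet> w" if "w \<in> carrier_vec n" for w
    unfolding c_def using transpose_vec_mult_scalar[of "U" n n w z] U z that by simp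
  have "A *\<^sub>v z = U *\<^sub>v (U\<^sup>T *\<^sub>v (A *\<^sub>v (U *\<^sub>v c)))"
    unfolding zc[symmetric] using UUw[of "A *\<^sub>v z"] A z by simp
  also have "U\<^sup>T *\<^sub>v (A *\<^sub>v (U *\<^sub>v c)) = mat_diag n d *\<^sub>v c"
    unfolding D[symmetric] using U A c by (simp add: assoc_mult_mat_vec[of _ n n _ n])
  finally have "z \<bullet> (A *\<^sub>v z) = c \<bullet> (mat_diag n d *\<^sub>v c)"
    using adj[of "mat_diag n d *\<^sub>v c"] mult_mat_vec_carrier[OF _ c(1), of "mat_diag n d" n]
    by simp
  also have "\<dots> = (\<Sum>i<n. c $ i * (d i * c $ i))"
  proof -
    have "(mat_diag n d *\<^sub>v c) $ i = d i * c $ i" if "i < n" for i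
      using that c by (simp add: scalar_prod_def mat_diag_def if_distrib[of "\<lambda>x. x * _"] cong: if_cong)
    moreover have "dim_row (mat_diag n d) = n"
      by (simp add: mat_diag_def)
    ultimately show ?thesis
      by (simp add: scalar_prod_def[of c] atLeast0LessThan)
  qed
  finally show "z \<bullet> (A *\<^sub>v z) = (\<Sum>i<n. d i * (col U i \<bullet> z)\<^sup>2)"
    using c by (simp add: power2_eq_square mult_ac)
  have "z \<bullet> z = c \<bullet> c"
    using adj[OF c(1)] zc by simp
  then show "z \<bullet> z = (\<Sum>i<n. (col U i \<bullet> z)\<^sup>2)"
    using c by (simp add: scalar_prod_def power2_eq_square atLeast0LessThan)
qed

text \<open>
  Both bounds intersect a plane with a hyperplane. Below, the plane spanned by the two lowest
  eigenvectors meets the orthogonal complement of \<open>j\<close>; above, the plane spanned by \<open>x\<close> and the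
  kernel vector \<open>j\<close> meets the orthogonal complement of the lowest eigenvector.
\<close>

lemma second_eigenvalue_ge:
  fixes A :: "real mat"
  assumes A: "A \<in> carrier_mat n n" and sym: "A\<^sup>T = A" and n: "2 \<le> n"
    and j: "j \<in> carrier_vec n"
    and bound: "\<And>z. z \<in> carrier_vec n \<Longrightarrow> z \<bullet> j = 0 \<Longrightarrow> m * (z \<bullet> z) \<le> z \<bullet> (A *\<^sub>v z)"
  shows "m \<le> eigenvalue_list A ! 1"
proof -
  obtain U where U: "U \<in> carrier_mat n n" "U\<^sup>T * U = 1\<^sub>m n"
    and D: "U\<^sup>T * A * U = mat_diag n ((!) (eigenvalue_list A))"
    and es: "length (eigenvalue_list A) = n" "sorted (eigenvalue_list A)"
    using orthogonal_diagonalization_sorted[OF A sym] by blast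
  obtain k where k: "n = Suc (Suc k)"
    using n by (metis add_2_eq_Suc le_Suc_ex)
  \<comment> \<open>A nonzero solution of the orthogonality condition for \<open>y\<close>; the
    first branch avoids (0, 0) when both inner products with \<open>j\<close> vanish.\<close>
  define a b where "a = (if col U 0 \<bullet> j = 0 then 1 else col U 1 \<bullet> j)"
    and "b = (if col U 0 \<bullet> j = 0 then 0 else - (col U 0 \<bullet> j))"
  have ab: "a \<noteq> 0 \<or> b \<noteq> 0" "a * (col U 0 \<bullet> j) + b * (col U 1 \<bullet> j) = 0"
    by (auto simp: a_def b_def)
  define y where "y = a \<cdot>\<^sub>v col U 0 + b \<cdot>\<^sub>v col U 1"
  have cols: "col U i \<in> carrier_vec n" for i
    using U by auto
  have y: "y \<in> carrier_vec n"
    using cols by (simp add: y_def)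
  have "y \<bullet> j = 0"
    using ab(2) j cols
    by (simp add: y_def add_scalar_prod_distrib[of _ n] smult_scalar_prod_distrib[of _ n])
  note le = bound[OF y this]
  have orth: "col U i \<bullet> col U l = (if i = l then 1 else 0)" if "i < n" "l < n" for i l
    using arg_cong[OF U(2), of "\<lambda>M. M $$ (i, l)"] U(1) that by simp
  have "col U i \<bullet> y = (if i = 0 then a else if i = 1 then b else 0)" if "i < n" for i
    using that orth[of i 0] orth[of i 1] cols k
    by (simp add: y_def scalar_prod_add_distrib[of _ n])
  then have "y \<bullet> (A *\<^sub>v y) = (\<Sum>i<n. eigenvalue_list A ! i * (if i = 0 then a else if i = 1 then b else 0)\<^sup>2)"
    and yy: "y \<bullet> y = (\<Sum>i<n. (if i = 0 then a else if i = 1 then b else 0)\<^sup>2)"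
    using orthogonal_quadratic_forms[OF A U D y] by simp_all
  then have "y \<bullet> (A *\<^sub>v y) = eigenvalue_list A ! 0 * a\<^sup>2 + eigenvalue_list A ! 1 * b\<^sup>2"
    unfolding k by (simp add: sum.lessThan_Suc_shift del: sum.lessThan_Suc)
  also have "\<dots> \<le> eigenvalue_list A ! 1 * (y \<bullet> y)"
    using es k yy unfolding k
    by (simp add: sum.lessThan_Suc_shift sorted_iff_nth_mono algebra_simps mult_right_mono del: sum.lessThan_Suc)
  finally have "m * (y \<bullet> y) \<le> eigenvalue_list A ! 1 * (y \<bullet> y)"
    using le by simp
  moreover have "y \<bullet> y > 0"
    using yy ab(1) unfolding k
    by (simp add: sum.lessThan_Suc_shift sum_power2_gt_zero_iff del: sum.lessThan_Suc)
  ultimately show ?thesis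
    by simp
qed

lemma second_eigenvalue_le:
  fixes A :: "real mat"
  assumes A: "A \<in> carrier_mat n n" and sym: "A\<^sup>T = A" and n: "2 \<le> n"
    and psd: "\<And>z. z \<in> carrier_vec n \<Longrightarrow> 0 \<le> z \<bullet> (A *\<^sub>v z)"
    and j: "j \<in> carrier_vec n" "j \<noteq> 0\<^sub>v n" "A *\<^sub>v j = 0\<^sub>v n"
    and x: "x \<in> carrier_vec n" "x \<bullet> j = 0"
  shows "eigenvalue_list A ! 1 * (x \<bullet> x) \<le> x \<bullet> (A *\<^sub>v x)"
proof -
  obtain U where U: "U \<in> carrier_mat n n" "U\<^sup>T * U = 1\<^sub>m n"
    and D: "U\<^sup>T * A * U = mat_diag n ((!) (eigenvalue_list A))"
    and es: "length (eigenvalue_list A) = n" "sorted (eigenvalue_list A)"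
    using orthogonal_diagonalization_sorted[OF A sym] by blast
  define e where "e = eigenvalue_list A ! 1"
  \<comment> \<open>Positive semidefiniteness is the lower bound with \<open>m = 0\<close>.\<close>
  have e0: "0 \<le> e"
    unfolding e_def using psd second_eigenvalue_ge[OF A sym n j(1), of 0] by simp
  have u0: "col U 0 \<in> carrier_vec n"
    using U by auto
  have lower: "e * (z \<bullet> z) \<le> z \<bullet> (A *\<^sub>v z)" if z: "z \<in> carrier_vec n" "col U 0 \<bullet> z = 0" for z
  proof -
    have "e * (col U i \<bullet> z)\<^sup>2 \<le> eigenvalue_list A ! i * (col U i \<bullet> z)\<^sup>2" if "i < n" for i
      using that es z(2) unfolding e_def
      by (cases "i = 0") (auto simp: sorted_iff_nth_mono intro!: mult_right_mono)
    then show ?thesis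
      unfolding orthogonal_quadratic_forms[OF A U D z(1)] sum_distrib_left
      by (intro sum_mono) auto
  qed
  have jj: "0 < j \<bullet> j"
    using j(1,2) conjugate_square_greater_0_vec[of j n] by simp
  show ?thesis
  proof (cases "col U 0 \<bullet> j = 0")
    case True
    \<comment> \<open>Here \<open>j\<close> itself is orthogonal to the lowest eigenvector, and its
      form is zero.\<close>
    then have "e * (j \<bullet> j) \<le> 0"
      using lower[OF j(1)] j by simp
    then have "e = 0"
      using e0 jj by (simp add: mult_le_0_iff)
    then show ?thesis
      using psd[OF x(1)] unfolding e_def by simp
  next
    case False
    \<comment> \<open>This \<open>t\<close> makes \<open>z\<close> orthogonal to the lowest
      eigenvector. Adding a multiple of the kernel vector keeps the form, and the norm can only grow
      because \<open>x\<close> is orthogonal to \<open>j\<close>; as \<open>e\<close> is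
      nonnegative, the bound for \<open>z\<close> gives the one for \<open>x\<close>.\<close>
    define t where "t = - (col U 0 \<bullet> x) / (col U 0 \<bullet> j)"
    define z where "z = x + t \<cdot>\<^sub>v j"
    have z: "z \<in> carrier_vec n" "col U 0 \<bullet> z = 0"
      using x j u0 False by (auto simp: z_def t_def scalar_prod_add_distrib[of _ n])
    have jx: "j \<bullet> x = 0"
      using x j comm_scalar_prod by metis
    have "t \<cdot>\<^sub>v 0\<^sub>v n = 0\<^sub>v n"
      by auto
    then have "A *\<^sub>v z = A *\<^sub>v x"
      using A x j by (simp add: z_def mult_add_distrib_mat_vec[of _ n n] mult_mat_vec[of _ n n])
    moreover have "j \<bullet> (A *\<^sub>v x) = 0"
      using transpose_vec_mult_scalar[OF A x(1) j(1)] sym j(3) x by simp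
    ultimately have "z \<bullet> (A *\<^sub>v z) = x \<bullet> (A *\<^sub>v x)"
      using x j A by (simp add: z_def add_scalar_prod_distrib[of _ n])
    moreover have "z \<bullet> z = x \<bullet> x + t\<^sup>2 * (j \<bullet> j)"
      using x j jx by (simp add: z_def add_scalar_prod_distrib[of _ n] scalar_prod_add_distrib[of _ n] power2_eq_square)
    ultimately have "e * (x \<bullet> x) + e * (t\<^sup>2 * (j \<bullet> j)) \<le> x \<bullet> (A *\<^sub>v x)"
      using lower[OF z] by (simp add: algebra_simps)
    moreover have "0 \<le> e * (t\<^sup>2 * (j \<bullet> j))"
      using e0 jj by simp
    ultimately show ?thesis
      unfolding e_def by linarith
  qed
qed

section \<open>The Laplacian quadratic form\<close>

text \<open>Follows the vertex enumeration of the Laplacian matrix, so that functions on vertices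
  and coordinate vectors can be exchanged.\<close>

definition vertex_vec :: "'a::linorder pair_pre_digraph \<Rightarrow> ('a \<Rightarrow> real) \<Rightarrow> real vec" where
  "vertex_vec G f = vec (card (pverts G)) (\<lambda>i. f (sorted_list_of_set (pverts G) ! i))"

text \<open>Each edge is counted in both orientations, so this is twice the Laplacian form.\<close>

definition dirichlet :: "'a pair_pre_digraph \<Rightarrow> ('a \<Rightarrow> real) \<Rightarrow> real" where
  "dirichlet G f = (\<Sum>(u, v)\<in>parcs G. (f u - f v)\<^sup>2)"

lemma vertex_vec_carrier [simp]: "vertex_vec G f \<in> carrier_vec (card (pverts G))"
  by (simp add: vertex_vec_def)

lemma scalar_prod_vertex_vec:
  assumes "finite (pverts G)"
  shows "vertex_vec G f \<bullet> vertex_vec G g = (\<Sum>v\<in>pverts G. f v * g v)"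
proof -
  have "bij_betw ((!) (sorted_list_of_set (pverts G))) {..<card (pverts G)} (pverts G)"
    using assms by (intro bij_betw_nth) auto
  from sum.reindex_bij_betw[OF this, of "\<lambda>v. f v * g v"] show ?thesis
    by (simp add: scalar_prod_def vertex_vec_def atLeast0LessThan)
qed

lemma vertex_vec_surj:
  assumes "finite (pverts G)" "z \<in> carrier_vec (card (pverts G))"
  obtains f where "z = vertex_vec G f"
proof -
  have inj: "inj_on ((!) (sorted_list_of_set (pverts G))) {..<card (pverts G)}"
    using assms(1) by (intro inj_on_nth) auto
  have "z = vertex_vec G (\<lambda>v. z $ the_inv_into {..<card (pverts G)} ((!) (sorted_list_of_set (pverts G))) v)"
    using assms(2) inj by (intro eq_vecI) (auto simp: vertex_vec_def the_inv_into_f_f)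
  then show ?thesis
    using that by blast
qed

locale linorder_pair_graph = pair_graph G for G :: "'a::linorder pair_pre_digraph"
begin

lemma laplacian_carrier:
  "laplacian_matrix (with_proj G) \<in> carrier_mat (card (pverts G)) (card (pverts G))"
  unfolding laplacian_matrix_def degree_matrix_def adjacency_matrix_def Let_def
  by (intro minus_carrier_mat) simp

lemma out_degree_eq: "out_degree (with_proj G) u = card {v \<in> pverts G. (u, v) \<in> parcs G}"
proof -
  have "out_arcs (with_proj G) u = Pair u ` {v \<in> pverts G. (u, v) \<in> parcs G}"
    by (auto simp: out_arcs_def in_arcsD2)
  then show ?thesis
    by (simp add: out_degree_def card_image inj_on_def)
qed

lemma laplacian_matrix_transpose:
  shows "(laplacian_matrix (with_proj G))\<^sup>T = laplacian_matrix (with_proj G)"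
  using arcs_symmetric
  by (intro eq_matI) (auto simp: laplacian_matrix_def degree_matrix_def adjacency_matrix_def Let_def)

lemma laplacian_mult_vertex_vec:
  shows "laplacian_matrix (with_proj G) *\<^sub>v vertex_vec G f =
    vertex_vec G (\<lambda>u. \<Sum>v\<in>{v\<in>pverts G. (u, v) \<in> parcs G}. f u - f v)"
proof -
  let ?n = "card (pverts G)" and ?vs = "sorted_list_of_set (pverts G)"
  let ?N = "\<lambda>u. {v\<in>pverts G. (u, v) \<in> parcs G}"
  have bij: "bij_betw ((!) ?vs) {..<?n} (pverts G)"
    using pair_finite_verts by (intro bij_betw_nth) auto
  have "(laplacian_matrix (with_proj G) *\<^sub>v vertex_vec G f) $ i =
      (\<Sum>v\<in>?N (?vs ! i). f (?vs ! i) - f v)" if i: "i < ?n" for i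
  proof -
    have "(laplacian_matrix (with_proj G) *\<^sub>v vertex_vec G f) $ i =
      (\<Sum>j<?n. ((if i = j then real (card (?N (?vs ! i))) else 0) -
         (if (?vs ! i, ?vs ! j) \<in> parcs G then 1 else 0)) * f (?vs ! j))"
      using i laplacian_carrier
      by (auto simp: laplacian_matrix_def degree_matrix_def adjacency_matrix_def Let_def
        scalar_prod_def vertex_vec_def atLeast0LessThan out_degree_eq intro!: sum.cong)
    also have "\<dots> = real (card (?N (?vs ! i))) * f (?vs ! i) -
        (\<Sum>j<?n. (if (?vs ! i, ?vs ! j) \<in> parcs G then f (?vs ! j) else 0))"
      using i by (simp add: left_diff_distrib sum_subtractf if_distrib[of "\<lambda>x. x * _"] cong: if_cong)
    also have "(\<Sum>j<?n. (if (?vs ! i, ?vs ! j) \<in> parcs G then f (?vs ! j) else 0)) =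
        (\<Sum>v\<in>pverts G. if (?vs ! i, v) \<in> parcs G then f v else 0)"
      by (rule sum.reindex_bij_betw[OF bij])
    also have "\<dots> = (\<Sum>v\<in>?N (?vs ! i). f v)"
      using pair_finite_verts by (simp add: sum.inter_filter)
    finally show ?thesis
      by (simp add: sum_subtractf)
  qed
  then show ?thesis
    using laplacian_carrier by (intro eq_vecI) (auto simp: vertex_vec_def)
qed

text \<open>The form is the sum of \<open>f u * (f u - f v)\<close> over all arcs; adding the same
  sum with orientations exchanged completes the square.\<close>

lemma laplacian_quadratic_form:
  shows "2 * (vertex_vec G f \<bullet> (laplacian_matrix (with_proj G) *\<^sub>v vertex_vec G f)) = dirichlet G f"
proof -
  let ?N = "\<lambda>u. {v\<in>pverts G. (u, v) \<in> parcs G}"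
  have arcs: "(SIGMA u:pverts G. ?N u) = parcs G"
    using in_arcsD1 in_arcsD2 by auto
  define S where "S = (\<Sum>(u, v)\<in>parcs G. f u * (f u - f v))"
  have "vertex_vec G f \<bullet> (laplacian_matrix (with_proj G) *\<^sub>v vertex_vec G f) =
      (\<Sum>u\<in>pverts G. \<Sum>v\<in>?N u. f u * (f u - f v))"
    unfolding laplacian_mult_vertex_vec scalar_prod_vertex_vec[OF pair_finite_verts]
    by (simp add: sum_distrib_left)
  also have "\<dots> = S"
    using pair_finite_verts by (simp add: sum.Sigma arcs S_def)
  finally have "vertex_vec G f \<bullet> (laplacian_matrix (with_proj G) *\<^sub>v vertex_vec G f) = S" .
  moreover have S': "S = (\<Sum>(u, v)\<in>parcs G. f v * (f v - f u))"
    unfolding S_def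
    by (rule sum.reindex_bij_witness[of _ prod.swap prod.swap]) (auto intro: arcs_symmetric)
  have "(\<Sum>(u, v)\<in>parcs G. f u * (f u - f v)) + (\<Sum>(u, v)\<in>parcs G. f v * (f v - f u)) = dirichlet G f"
    unfolding sum.distrib[symmetric] dirichlet_def
    by (intro sum.cong) (auto simp: power2_eq_square algebra_simps)
  then have "S + S = dirichlet G f"
    unfolding S_def[symmetric] S'[symmetric] .
  ultimately show ?thesis
    by simp
qed

lemma laplacian_eigenvalue_second:
  assumes "2 \<le> card (pverts G)"
  shows "laplacian_eigenvalue (with_proj G) (card (pverts G) - 1) =
    eigenvalue_list (laplacian_matrix (with_proj G)) ! 1"
proof -
  have "length (eigenvalue_list (laplacian_matrix (with_proj G))) = card (pverts G)"
    using orthogonal_diagonalization_sorted[OF laplacian_carrier laplacian_matrix_transpose]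
    by blast
  then show ?thesis
    using assms unfolding laplacian_eigenvalue_def eigenvalue_list_def[symmetric]
    by (simp add: rev_nth)
qed

text \<open>The constant vector is in the kernel of the Laplacian, and orthogonality to it is the
  zero-sum condition. The factor 2 matches the two orientations counted by
  \<open>dirichlet\<close>.\<close>

lemma algebraic_connectivity_le:
  assumes G: "2 \<le> card (pverts G)"
    and f: "(\<Sum>v\<in>pverts G. f v) = 0"
  shows "2 * laplacian_eigenvalue (with_proj G) (card (pverts G) - 1) * (\<Sum>v\<in>pverts G. (f v)\<^sup>2)
    \<le> dirichlet G f"
proof -
  let ?n = "card (pverts G)" and ?L = "laplacian_matrix (with_proj G)"
  let ?one = "vertex_vec G (\<lambda>_. 1)"
  have "eigenvalue_list ?L ! 1 * (vertex_vec G f \<bullet> vertex_vec G f)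
    \<le> vertex_vec G f \<bullet> (?L *\<^sub>v vertex_vec G f)"
  proof (rule second_eigenvalue_le[OF laplacian_carrier laplacian_matrix_transpose G, where j = ?one])
    fix z :: "real vec" assume "z \<in> carrier_vec ?n"
    then obtain g where "z = vertex_vec G g"
      using vertex_vec_surj[OF pair_finite_verts] by blast
    moreover have "0 \<le> dirichlet G g"
      unfolding dirichlet_def by (intro sum_nonneg) auto
    ultimately show "0 \<le> z \<bullet> (?L *\<^sub>v z)"
      using laplacian_quadratic_form[of g] by simp
  next
    have "?one $ 0 \<noteq> 0\<^sub>v ?n $ 0"
      using G by (simp add: vertex_vec_def)
    then show "?one \<noteq> 0\<^sub>v ?n" by metis
    show "?L *\<^sub>v ?one = 0\<^sub>v ?n"
      unfolding laplacian_mult_vertex_vec by (auto simp: vertex_vec_def)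
    show "vertex_vec G f \<bullet> ?one = 0"
      using f by (simp add: scalar_prod_vertex_vec[OF pair_finite_verts])
  qed auto
  then show ?thesis
    unfolding laplacian_eigenvalue_second[OF G] laplacian_quadratic_form[symmetric]
    by (simp add: scalar_prod_vertex_vec[OF pair_finite_verts] power2_eq_square)
qed

lemma algebraic_connectivity_ge:
  assumes G: "2 \<le> card (pverts G)"
    and f: "\<And>f. (\<Sum>v\<in>pverts G. f v) = 0 \<Longrightarrow> 2 * m * (\<Sum>v\<in>pverts G. (f v)\<^sup>2) \<le> dirichlet G f"
  shows "m \<le> laplacian_eigenvalue (with_proj G) (card (pverts G) - 1)"
proof -
  let ?n = "card (pverts G)" and ?L = "laplacian_matrix (with_proj G)"
  let ?one = "vertex_vec G (\<lambda>_. 1)"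
  have "m \<le> eigenvalue_list ?L ! 1"
  proof (rule second_eigenvalue_ge[OF laplacian_carrier laplacian_matrix_transpose G, where j = ?one])
    fix z :: "real vec" assume "z \<in> carrier_vec ?n" and orth: "z \<bullet> ?one = 0"
    then obtain g where g: "z = vertex_vec G g"
      using vertex_vec_surj[OF pair_finite_verts] by blast
    show "m * (z \<bullet> z) \<le> z \<bullet> (?L *\<^sub>v z)"
      using f[of g] orth laplacian_quadratic_form[of g]
      by (simp add: g scalar_prod_vertex_vec[OF pair_finite_verts] power2_eq_square)
  qed auto
  then show ?thesis
    unfolding laplacian_eigenvalue_second[OF G] .
qed

end

section \<open>Cuts and dominating vertices\<close>

lemma double_sum_diff_square:
  fixes f :: "'a \<Rightarrow> real"
  shows "(\<Sum>a\<in>A. \<Sum>b\<in>B. (f a - f b)\<^sup>2) =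
    card B * (\<Sum>a\<in>A. (f a)\<^sup>2) + card A * (\<Sum>b\<in>B. (f b)\<^sup>2) - 2 * (\<Sum>a\<in>A. f a) * (\<Sum>b\<in>B. f b)"
  by (simp add: power2_diff sum.distrib sum_subtractf mult.assoc flip: sum_distrib_left sum_distrib_right)

section \<open>Separations and vertex connectivity\<close>

context pair_pre_digraph
begin

text \<open>The two sets need not cover the graph; the vertices outside them form the cut.\<close>

definition separated :: "'a set \<Rightarrow> 'a set \<Rightarrow> bool" where
  "separated A B \<longleftrightarrow> A \<subseteq> pverts G \<and> B \<subseteq> pverts G \<and> A \<noteq> {} \<and> B \<noteq> {} \<and> A \<inter> B = {} \<and>
    (\<forall>a\<in>A. \<forall>b\<in>B. (a, b) \<notin> parcs G)"

end

context pair_graph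
begin

lemma connected_induce_subgraph_iff:
  "connected (with_proj G \<restriction> T) \<longleftrightarrow>
    T \<noteq> {} \<and> (\<forall>u\<in>T. \<forall>v\<in>T. (u, v) \<in> rtrancl_on T {(a, b) \<in> parcs G. a \<in> T \<and> b \<in> T})"
proof -
  have "symcl (arcs_ends (with_proj G \<restriction> T)) = {(a, b) \<in> parcs G. a \<in> T \<and> b \<in> T}"
    by (force simp: symcl_def arcs_ends_conv intro: arcs_symmetric)
  then show ?thesis
    by (simp add: connected_conv)
qed

lemma not_connected_induce_subgraphE:
  assumes "\<not> connected (with_proj G \<restriction> T)" "T \<noteq> {}" "T \<subseteq> pverts G"
  obtains A B where "separated A B" "A \<union> B = T"
proof -
  let ?R = "{(a, b) \<in> parcs G. a \<in> T \<and> b \<in> T}"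
  obtain u v where uv: "u \<in> T" "v \<in> T" "(u, v) \<notin> rtrancl_on T ?R"
    using assms unfolding connected_induce_subgraph_iff by blast
  \<comment> \<open>The vertices reachable from \<open>u\<close>; no arc leaves this set within
    \<open>T\<close>.\<close>
  define A where "A = {w \<in> T. (u, w) \<in> rtrancl_on T ?R}"
  have "u \<in> A" "v \<in> T - A"
    using uv by (auto simp: A_def)
  moreover have "(a, b) \<notin> parcs G" if "a \<in> A" "b \<in> T - A" for a b
    using that rtrancl_on_into_rtrancl_on[of u a T ?R b] by (auto simp: A_def)
  ultimately have "separated A (T - A)"
    using assms(3) unfolding separated_def A_def by blast
  then show ?thesis
    using that[of A "T - A"] by (auto simp: A_def)
qed

lemma separated_not_connected:
  assumes "separated A B"
  shows "\<not> connected (with_proj G \<restriction> (A \<union> B))"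
proof
  let ?R = "{(a, b) \<in> parcs G. a \<in> A \<union> B \<and> b \<in> A \<union> B}"
  assume conn: "connected (with_proj G \<restriction> (A \<union> B))"
  obtain a b where ab: "a \<in> A" "b \<in> B"
    using assms unfolding separated_def by blast
  have "(a, b) \<in> rtrancl_on (A \<union> B) ?R"
    using conn ab unfolding connected_induce_subgraph_iff by blast
  then have "b \<in> A"
    by (induction rule: rtrancl_on_induct) (use ab assms in \<open>auto simp: separated_def\<close>)
  then show False
    using ab assms unfolding separated_def by blast
qed

lemma vertex_connectivity_le:
  assumes "separated A B"
  shows "vertex_connectivity (with_proj G) \<le> card (pverts G - (A \<union> B))"
proof -
  have "A \<union> B \<subseteq> pverts G"
    using assms by (auto simp: separated_def)
  then have eq: "pverts G - (pverts G - (A \<union> B)) = A \<union> B"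
    by blast
  show ?thesis
    unfolding vertex_connectivity_def
    by (rule Least_le, rule exI[of _ "pverts G - (A \<union> B)"])
       (use separated_not_connected[OF assms] pair_finite_verts eq in simp)
qed

lemma separated_singletons:
  assumes "u \<in> pverts G" "v \<in> pverts G" "u \<noteq> v" "(u, v) \<notin> parcs G"
  shows "separated {u} {v}"
  using assms by (auto simp: separated_def)

text \<open>A minimum removal either disconnects the graph or leaves one vertex. In the second case,
  removing everything except a nonadjacent pair would be a smaller cut, so the graph is
  complete.\<close>

lemma vertex_connectivity_cases:
  assumes "pverts G \<noteq> {}"
  obtains (complete) "\<And>u v. u \<in> pverts G \<Longrightarrow> v \<in> pverts G \<Longrightarrow> u \<noteq> v \<Longrightarrow> (u, v) \<in> parcs G"
    "vertex_connectivity (with_proj G) < card (pverts G)"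
  | (cut) A B where "separated A B" "vertex_connectivity (with_proj G) = card (pverts G - (A \<union> B))"
proof -
  let ?\<kappa> = "vertex_connectivity (with_proj G)"
  let ?P = "\<lambda>k. \<exists>S \<subseteq> pverts G. finite S \<and> card S = k \<and>
      (\<not> connected (with_proj G \<restriction> (pverts G - S)) \<or> card (pverts G - S) = 1)"
  obtain x where x: "x \<in> pverts G"
    using assms by blast
  have \<kappa>: "?\<kappa> = (LEAST k. ?P k)"
    by (simp add: vertex_connectivity_def)
  have P: "?P (card (pverts G - {x}))"
    by (rule exI[of _ "pverts G - {x}"])
       (use x pair_finite_verts in \<open>auto simp: Int_absorb1 Diff_Diff_Int\<close>)
  have "?\<kappa> \<le> card (pverts G - {x})"
    unfolding \<kappa> using P by (rule Least_le)
  also have "\<dots> < card (pverts G)"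
    using x pair_finite_verts by (intro psubset_card_mono) auto
  finally have less: "?\<kappa> < card (pverts G)" .
  obtain S where S: "S \<subseteq> pverts G" "card S = ?\<kappa>"
    "\<not> connected (with_proj G \<restriction> (pverts G - S)) \<or> card (pverts G - S) = 1"
    using LeastI[of ?P, OF P] unfolding \<kappa> by blast
  have ne: "pverts G - S \<noteq> {}"
    using S less by auto
  show ?thesis
  proof (cases "connected (with_proj G \<restriction> (pverts G - S))")
    case False
    then obtain A B where AB: "separated A B" "A \<union> B = pverts G - S"
      using not_connected_induce_subgraphE ne by blast
    then have "pverts G - (A \<union> B) = S"
      using S(1) by blast
    then show ?thesis
      using cut AB(1) S(2) by metis
  next
    case True
    then have card_S: "card (pverts G) = Suc ?\<kappa>"
      using S pair_finite_verts by (simp add: card_Diff_subset finite_subset)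
    have "(u, v) \<in> parcs G" if uv: "u \<in> pverts G" "v \<in> pverts G" "u \<noteq> v" for u v
    proof (rule ccontr)
      assume "(u, v) \<notin> parcs G"
      then have "?\<kappa> \<le> card (pverts G - {u, v})"
        using vertex_connectivity_le[OF separated_singletons[OF uv]] by (simp add: insert_commute)
      also have "\<dots> = card (pverts G) - 2"
        using uv pair_finite_verts by (simp add: card_Diff_subset)
      finally show False
        using card_S card_mono[OF pair_finite_verts, of "{u, v}"] uv by simp
    qed
    then show ?thesis
      using complete less by blast
  qed
qed

end

section \<open>Algebraic connectivity against dominating sets and cuts\<close>

context linorder_pair_graph
begin

text \<open>Only arcs with an end in \<open>D\<close> are kept. As the values sum to zero, the cross
  term over \<open>D\<close> and all vertices vanishes, and what exceeds the claimed bound is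
  nonnegative.\<close>

lemma algebraic_connectivity_ge_dominating:
  assumes card: "2 \<le> card (pverts G)" and D: "D \<subseteq> pverts G"
    and dom: "\<And>d v. d \<in> D \<Longrightarrow> v \<in> pverts G \<Longrightarrow> d \<noteq> v \<Longrightarrow> (d, v) \<in> parcs G"
  shows "card D \<le> laplacian_eigenvalue (with_proj G) (card (pverts G) - 1)"
proof (rule algebraic_connectivity_ge[OF card])
  fix f :: "'a \<Rightarrow> real" assume f0: "(\<Sum>v\<in>pverts G. f v) = 0"
  let ?V = "pverts G" and ?h = "\<lambda>(u, v). (f u - f v)\<^sup>2"
  let ?Q = "D \<times> ?V \<union> ?V \<times> D"
  have fin: "finite ?V" "finite D"
    using pair_finite_verts finite_subset[OF D pair_finite_verts] by auto
  \<comment> \<open>The two rectangles of \<open>?Q\<close> overlap in the square of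
    \<open>D\<close>.\<close>
  have "sum ?h ?Q + sum ?h (D \<times> D) = sum ?h (D \<times> ?V) + sum ?h (?V \<times> D)"
    using sum.union_inter[of "D \<times> ?V" "?V \<times> D" ?h] fin D
    by (simp add: Times_Int_Times Int_absorb1 Int_absorb2)
  also have "sum ?h (?V \<times> D) = sum ?h (D \<times> ?V)"
    by (rule sum.reindex_bij_witness[of _ prod.swap prod.swap]) (auto simp: power2_commute)
  finally have "sum ?h ?Q = 2 * (\<Sum>d\<in>D. \<Sum>v\<in>?V. (f d - f v)\<^sup>2) - (\<Sum>d\<in>D. \<Sum>e\<in>D. (f d - f e)\<^sup>2)"
    by (simp add: sum.cartesian_product)
  also have "\<dots> = 2 * card D * (\<Sum>v\<in>?V. (f v)\<^sup>2) + 2 * (\<Sum>d\<in>D. f d)\<^sup>2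
      + 2 * (real (card ?V) - real (card D)) * (\<Sum>d\<in>D. (f d)\<^sup>2)"
    unfolding double_sum_diff_square f0 by (simp add: power2_eq_square algebra_simps)
  finally have "2 * card D * (\<Sum>v\<in>?V. (f v)\<^sup>2) \<le> sum ?h ?Q"
    using card_mono[OF fin(1) D] by (simp add: sum_nonneg)
  \<comment> \<open>Diagonal pairs are not arcs, but they contribute zero.\<close>
  also have "sum ?h ?Q = sum ?h (?Q - Id)"
    using fin by (intro sum.mono_neutral_right) auto
  also have "\<dots> \<le> dirichlet G f"
    unfolding dirichlet_def using pair_finite_arcs dom by (intro sum_mono2) (auto intro: arcs_symmetric)
  finally show "2 * real (card D) * (\<Sum>v\<in>?V. (f v)\<^sup>2) \<le> dirichlet G f"
    by simp
qed

text \<open>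
  Only arcs joining the cut to \<open>A \<union> B\<close> contribute to the Dirichlet sum of the test function, and a
  missing one makes the estimate strict.
\<close>

lemma algebraic_connectivity_cut:
  assumes sep: "separated A B"
  defines "S \<equiv> pverts G - (A \<union> B)"
  defines "ac \<equiv> laplacian_eigenvalue (with_proj G) (card (pverts G) - 1)"
  shows "ac \<le> card S"
    and "ac = card S \<Longrightarrow> s \<in> S \<Longrightarrow> v \<in> A \<union> B \<Longrightarrow> (s, v) \<in> parcs G"
proof -
  define f where "f v = (if v \<in> A then real (card B) else if v \<in> B then - real (card A) else 0)" for v
  define N where "N = (\<Sum>v\<in>pverts G. (f v)\<^sup>2)"
  define X where "X = parcs G \<inter> S \<times> (A \<union> B)"
  let ?h = "\<lambda>(u, v). (f u - f v)\<^sup>2"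
  have AB: "A \<subseteq> pverts G" "B \<subseteq> pverts G" "A \<inter> B = {}" "A \<noteq> {}" "B \<noteq> {}"
    and no_arc: "\<And>a b. a \<in> A \<Longrightarrow> b \<in> B \<Longrightarrow> (a, b) \<notin> parcs G"
    using sep by (auto simp: separated_def)
  have fin: "finite (pverts G)" "finite A" "finite B" "finite S"
    using pair_finite_verts finite_subset[OF AB(1)] finite_subset[OF AB(2)] by (auto simp: S_def)
  have cards: "card A > 0" "card B > 0"
    using fin AB by (auto simp: card_gt_0_iff)
  have "card (A \<union> B) \<le> card (pverts G)"
    using AB fin by (intro card_mono) auto
  then have card2: "2 \<le> card (pverts G)"
    using cards AB(3) fin by (simp add: card_Un_disjoint)
  have fS: "f s = 0" if "s \<in> S" for s
    using that by (auto simp: f_def S_def)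
  have fAB: "f v \<noteq> 0" if "v \<in> A \<union> B" for v
    using that cards by (auto simp: f_def)
  \<comment> \<open>Stated for general \<open>g\<close>: the identity yields the zero sum, the
    square yields the norm.\<close>
  have sum_f: "(\<Sum>v\<in>pverts G. g (f v)) = card A * g (real (card B)) + card B * g (- real (card A))"
    if "g 0 = 0" for g :: "real \<Rightarrow> real"
  proof -
    have "(\<Sum>v\<in>pverts G. g (f v)) = (\<Sum>v\<in>A \<union> B. g (f v))"
      using fin AB that fS by (intro sum.mono_neutral_right) (auto simp: S_def)
    also have "\<dots> = (\<Sum>v\<in>A. g (f v)) + (\<Sum>v\<in>B. g (f v))"
      using fin AB by (intro sum.union_disjoint) auto
    also have "(\<Sum>v\<in>A. g (f v)) = (\<Sum>v\<in>A. g (real (card B)))"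
      by (intro sum.cong) (auto simp: f_def)
    also have "(\<Sum>v\<in>B. g (f v)) = (\<Sum>v\<in>B. g (- real (card A)))"
      using AB by (intro sum.cong) (auto simp: f_def)
    finally show ?thesis
      by simp
  qed
  have f0: "(\<Sum>v\<in>pverts G. f v) = 0"
    using sum_f[of "\<lambda>x. x"] by simp
  have N: "N > 0"
    unfolding N_def using sum_f[of "\<lambda>x. x\<^sup>2"] cards by (simp add: add_pos_pos)
  have "dirichlet G f = sum ?h (X \<union> X\<inverse>)"
    unfolding dirichlet_def
  proof (intro sum.mono_neutral_right ballI)
    show "X \<union> X\<inverse> \<subseteq> parcs G"
      by (auto simp: X_def intro: arcs_symmetric)
    fix e assume e: "e \<in> parcs G - (X \<union> X\<inverse>)"
    obtain u v where uv: "e = (u, v)" by (cases e)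
    have V: "u \<in> pverts G" "v \<in> pverts G"
      using e uv in_arcsD1 in_arcsD2 by auto
    have arcs: "(u, v) \<in> parcs G" "(v, u) \<in> parcs G"
      using e uv arcs_symmetric by auto
    consider "u \<in> S" "v \<in> S" | "u \<in> A" "v \<in> A" | "u \<in> B" "v \<in> B"
      using e V arcs no_arc unfolding uv X_def S_def by blast
    then have "f u = f v"
      by cases (use fS AB in \<open>auto simp: f_def\<close>)
    then show "?h e = 0"
      by (simp add: uv)
  qed (use pair_finite_arcs in auto)
  also have "\<dots> = sum ?h X + sum ?h (X\<inverse>)"
    using pair_finite_arcs by (intro sum.union_disjoint) (auto simp: X_def S_def)
  also have "sum ?h (X\<inverse>) = sum ?h X"
    by (rule sum.reindex_bij_witness[of _ prod.swap prod.swap]) (auto simp: power2_commute)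
  also have "sum ?h X = (\<Sum>(s, v)\<in>X. (f v)\<^sup>2)"
    using fS by (intro sum.cong) (auto simp: X_def)
  finally have D: "dirichlet G f = 2 * (\<Sum>(s, v)\<in>X. (f v)\<^sup>2)"
    by simp
  have le: "ac * N \<le> (\<Sum>(s, v)\<in>X. (f v)\<^sup>2)"
    using algebraic_connectivity_le[OF card2 f0] unfolding D N_def ac_def by simp
  \<comment> \<open>The comparison value: what the sum over \<open>X\<close> would be if every pair
    in \<open>S\<close> times \<open>A \<union> B\<close> were an arc.\<close>
  have "(\<Sum>v\<in>A \<union> B. (f v)\<^sup>2) = N"
    unfolding N_def using fin AB fS by (intro sum.mono_neutral_left) (auto simp: S_def)
  then have full: "(\<Sum>(s, v)\<in>S \<times> (A \<union> B). (f v)\<^sup>2) = card S * N"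
    by (simp add: sum.cartesian_product[symmetric])
  have finX: "finite (S \<times> (A \<union> B))" "X \<subseteq> S \<times> (A \<union> B)"
    using fin by (auto simp: X_def)
  have "(\<Sum>(s, v)\<in>X. (f v)\<^sup>2) \<le> (\<Sum>(s, v)\<in>S \<times> (A \<union> B). (f v)\<^sup>2)"
    using finX by (intro sum_mono2) auto
  then have "ac * N \<le> card S * N"
    using le full by simp
  then show "ac \<le> card S"
    using N by simp
  show "(s, v) \<in> parcs G" if eq: "ac = card S" and s: "s \<in> S" and v: "v \<in> A \<union> B"
  proof (rule ccontr)
    assume "(s, v) \<notin> parcs G"
    then have "(\<Sum>(s, v)\<in>X. (f v)\<^sup>2) < (\<Sum>(s, v)\<in>S \<times> (A \<union> B). (f v)\<^sup>2)"
      using finX s v fAB by (intro sum_strict_mono2[where b = "(s, v)"]) (auto simp: X_def)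
    then show False
      using le full eq by simp
  qed
qed

end

section \<open>Power graphs of cyclic groups\<close>

definition dvd_incomparable :: "nat \<Rightarrow> nat \<Rightarrow> bool" where
  "dvd_incomparable a b \<longleftrightarrow> \<not> a dvd b \<and> \<not> b dvd a"

lemma dvd_incomparable_sym: "dvd_incomparable a b \<Longrightarrow> dvd_incomparable b a"
  by (auto simp: dvd_incomparable_def)

lemma prime_power_divisors_comparable:
  fixes p :: nat
  assumes "prime p" "a dvd p ^ k" "b dvd p ^ k"
  shows "a dvd b \<or> b dvd a"
proof -
  obtain i j where "a = p ^ i" "b = p ^ j"
    using assms by (auto simp: divides_primepow_nat)
  then show ?thesis
    using le_imp_power_dvd linear by metis
qed

text \<open>
  A divisor \<open>d\<close> outside \<open>T\<close> is comparable to all of \<open>T\<close>, so it is a common multiple or a common divisor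
  of \<open>\<alpha>\<close> and \<open>\<beta>\<close>. The contradiction comes from a divisor \<open>w\<close> that lies in \<open>T\<close> because it is incomparable to
  \<open>\<alpha>\<close> or \<open>\<beta>\<close>: in the first case a maximal prime power \<open>p ^ k\<close> dividing \<open>n\<close> but not \<open>d\<close>, in
  the second the cofactor \<open>n / p ^ k\<close> for a prime \<open>p\<close> dividing \<open>d\<close>.
\<close>

lemma incomparability_closed_contains_proper_divisors:
  fixes T :: "nat set"
  assumes n: "n > 0"
    and closed: "\<And>a w. a \<in> T \<Longrightarrow> w dvd n \<Longrightarrow> dvd_incomparable a w \<Longrightarrow> w \<in> T"
    and T: "\<alpha> \<in> T" "\<beta> \<in> T" "\<alpha> dvd n" "\<beta> dvd n" "dvd_incomparable \<alpha> \<beta>"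
    and d: "d dvd n" "d \<noteq> 1" "d \<noteq> n"
  shows "d \<in> T"
proof (rule ccontr)
  assume "d \<notin> T"
  then have cmp: "t dvd d \<or> d dvd t" if "t \<in> T" for t
    using closed[OF that d(1)] by (auto simp: dvd_incomparable_def)
  have cmp': "w dvd d \<or> d dvd w"
    if "w dvd n" "dvd_incomparable \<alpha> w \<or> dvd_incomparable \<beta> w" for w
    using that closed T cmp by blast
  have "d > 0"
    using d(1) n by (auto intro: Nat.gr0I)
  \<comment> \<open>In the mixed cases \<open>d\<close> would lie between \<alpha> and \<beta> and
    make them comparable.\<close>
  consider "\<alpha> dvd d" "\<beta> dvd d" | "d dvd \<alpha>" "d dvd \<beta>"
    using cmp[OF T(1)] cmp[OF T(2)] T(5) dvd_trans unfolding dvd_incomparable_def by blast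
  then show False
  proof cases
    case 1
    have "\<not> n dvd d"
      using d dvd_antisym by blast
    then obtain p where p: "prime p" "\<not> multiplicity p n \<le> multiplicity p d"
      using multiplicity_le_imp_dvd[of n d] n by auto
    define w where "w = p ^ multiplicity p n"
    have w: "w dvd n" "\<not> w dvd d"
      using p \<open>d > 0\<close> multiplicity_geI[of d p "multiplicity p n"] prime_gt_1_nat[OF p(1)]
      by (auto simp: w_def multiplicity_dvd)
    have "\<not> (\<alpha> dvd w \<and> \<beta> dvd w)"
      using prime_power_divisors_comparable[OF p(1), of \<alpha> _ \<beta>] T(5)
      unfolding w_def dvd_incomparable_def by blast
    then have "dvd_incomparable \<alpha> w \<or> dvd_incomparable \<beta> w"
      using 1 w(2) dvd_trans unfolding dvd_incomparable_def by blast
    then have "d dvd w"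
      using cmp' w by blast
    then show False
      using 1 \<open>\<not> (\<alpha> dvd w \<and> \<beta> dvd w)\<close> dvd_trans by blast
  next
    case 2
    obtain p where p: "prime p" "p dvd d"
      using d(2) prime_factor_nat by blast
    obtain w k where w: "n = w * p ^ k" "\<not> p dvd w"
      using multiplicity_decompose'[of n p] n prime_gt_1_nat[OF p(1)]
      by (metis mult.commute less_numeral_extra(3) nat_dvd_1_iff_1 less_irrefl)
    have ndvd: "\<not> d dvd w"
      using p w dvd_trans by blast
    have "\<not> (w dvd \<alpha> \<and> w dvd \<beta>)"
    proof
      assume "w dvd \<alpha> \<and> w dvd \<beta>"
      then obtain x y where xy: "\<alpha> = w * x" "\<beta> = w * y"
        by (auto elim!: dvdE)
      have "w > 0"
        using w(1) n by (auto intro: Nat.gr0I)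
      then have "x dvd p ^ k" "y dvd p ^ k"
        using T(3,4) unfolding xy w(1) by simp_all
      then show False
        using prime_power_divisors_comparable[OF p(1)] T(5) unfolding xy dvd_incomparable_def
        by (meson mult_dvd_mono dvd_refl)
    qed
    then have "dvd_incomparable \<alpha> w \<or> dvd_incomparable \<beta> w"
      using 2 ndvd dvd_trans unfolding dvd_incomparable_def by blast
    moreover have "w dvd n"
      using w(1) by simp
    ultimately have "w dvd d"
      using cmp' ndvd by blast
    then show False
      using 2 \<open>\<not> (w dvd \<alpha> \<and> w dvd \<beta>)\<close> dvd_trans by blast
  qed
qed

text \<open>\<open>P\<close> and \<open>Q\<close> stand for the labels on the two sides of a cut.
  They contain every proper divisor, but no common multiple or common divisor of some
  \<open>a\<close> in \<open>P\<close> and \<open>b\<close> in \<open>Q\<close>; hence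
  \<open>a * b = n\<close> for all such pairs. This leaves one label per side, and a nontrivial
  divisor of it would be a second label on that side.\<close>

lemma two_incomparable_classes:
  fixes P Q :: "nat set"
  assumes n: "n > 0" and dvd: "\<And>a. a \<in> P \<union> Q \<Longrightarrow> a dvd n"
    and PQ: "P \<noteq> {}" "Q \<noteq> {}" "\<And>a b. a \<in> P \<Longrightarrow> b \<in> Q \<Longrightarrow> dvd_incomparable a b"
    and closed: "\<And>a w. a \<in> P \<union> Q \<Longrightarrow> w dvd n \<Longrightarrow> dvd_incomparable a w \<Longrightarrow> w \<in> P \<union> Q"
  shows "\<exists>p q. prime p \<and> prime q \<and> p \<noteq> q \<and> n = p * q"
proof -
  obtain \<alpha> \<beta> where ab: "\<alpha> \<in> P" "\<beta> \<in> Q"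
    using PQ(1,2) by blast
  have all: "d \<in> P \<union> Q" if "d dvd n" "d \<noteq> 1" "d \<noteq> n" for d
    using incomparability_closed_contains_proper_divisors[OF n, where T = "P \<union> Q" and \<alpha> = \<alpha> and \<beta> = \<beta>]
      closed ab PQ(3)[OF ab] dvd that by blast
  have prod: "a * b = n" if "a \<in> P" "b \<in> Q" for a b
  proof -
    note inc = PQ(3)[OF that, unfolded dvd_incomparable_def]
    \<comment> \<open>An element of \<open>P\<close> is incomparable to \<open>b\<close>, and an
      element of \<open>Q\<close> to \<open>a\<close>.\<close>
    have comparable: False if "d \<in> P \<union> Q" "a dvd d \<and> b dvd d \<or> d dvd a \<and> d dvd b" for d
      using that PQ(3) \<open>a \<in> P\<close> \<open>b \<in> Q\<close> unfolding dvd_incomparable_def by blast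
    have "lcm a b = n"
    proof (rule ccontr)
      assume "lcm a b \<noteq> n"
      moreover have "lcm a b \<noteq> 1" "lcm a b dvd n"
        using inc dvd that by auto
      ultimately show False
        using all comparable[of "lcm a b"] by auto
    qed
    moreover have "gcd a b = 1"
    proof (rule ccontr)
      assume "gcd a b \<noteq> 1"
      moreover have "gcd a b \<noteq> n"
        using inc dvd[of b] that dvd_trans by (metis UnI2 gcd_dvd1)
      moreover have "gcd a b dvd n"
        using dvd[of a] that dvd_trans by (metis UnI1 gcd_dvd1)
      ultimately show False
        using all comparable[of "gcd a b"] by auto
    qed
    ultimately show ?thesis
      using prod_gcd_lcm_nat[of a b] by simp
  qed
  \<comment> \<open>1 and multiples of \<open>n\<close> are comparable to every divisor of
    \<open>n\<close>, while the opposite side is nonempty.\<close>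
  have nn: "a \<noteq> 1 \<and> \<not> n dvd a" if "a \<in> P \<union> Q" for a
    using that PQ dvd dvd_trans unfolding dvd_incomparable_def by (metis UnE UnI1 UnI2 all_not_in_conv one_dvd)
  have "prime \<alpha>"
    unfolding prime_nat_iff
  proof (intro conjI allI impI)
    show "1 < \<alpha>"
      using nn[of \<alpha>] ab prod[OF ab] n by (cases "\<alpha> = 0") auto
    fix d assume d: "d dvd \<alpha>"
    show "d = 1 \<or> d = \<alpha>"
    proof (rule ccontr)
      assume neg: "\<not> (d = 1 \<or> d = \<alpha>)"
      then have "d \<in> P \<union> Q"
        using all[of d] d dvd[of \<alpha>] ab nn[of \<alpha>] dvd_trans by blast
      moreover have "d \<notin> Q"
        using PQ(3)[OF ab(1)] d by (auto simp: dvd_incomparable_def)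
      ultimately have "d * \<beta> = \<alpha> * \<beta>"
        using prod ab by auto
      then show False
        using neg prod[OF ab] n by auto
    qed
  qed
  moreover have "prime \<beta>"
    unfolding prime_nat_iff
  proof (intro conjI allI impI)
    show "1 < \<beta>"
      using nn[of \<beta>] ab prod[OF ab] n by (cases "\<beta> = 0") auto
    fix d assume d: "d dvd \<beta>"
    show "d = 1 \<or> d = \<beta>"
    proof (rule ccontr)
      assume neg: "\<not> (d = 1 \<or> d = \<beta>)"
      then have "d \<in> P \<union> Q"
        using all[of d] d dvd[of \<beta>] ab nn[of \<beta>] dvd_trans by blast
      moreover have "d \<notin> P"
        using PQ(3)[OF _ ab(2)] d by (auto simp: dvd_incomparable_def)
      ultimately have "\<alpha> * d = \<alpha> * \<beta>"
        using prod ab by auto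
      then show False
        using neg prod[OF ab] n by auto
    qed
  qed
  ultimately show ?thesis
    using prod[OF ab] PQ(3)[OF ab] unfolding dvd_incomparable_def by (metis dvd_refl)
qed

text \<open>
  The order of \<open>u\<close> in the cyclic group is \<open>n\<close> divided by this number, so divisibility of orders is
  reversed divisibility of labels.
\<close>

definition gcd_label :: "nat \<Rightarrow> int \<Rightarrow> nat" where
  "gcd_label n u = nat (gcd u (int n))"

lemma gcd_label_dvd: "gcd_label n u dvd n"
  by (metis gcd_label_def gcd_dvd2 gcd_ge_0_int nat_dvd_iff nat_int of_nat_0_le_iff nat_abs_dvd_iff)

lemma gcd_label_surj:
  assumes "n > 0" "d dvd n"
  obtains u where "u \<in> {0..<int n}" "gcd_label n u = d"
proof -
  \<comment> \<open>The witness is reduced modulo \<open>n\<close> since for \<open>d = n\<close> it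
    must be 0, whose label is \<open>n\<close>.\<close>
  have "gcd (int d mod int n) (int n) = gcd (int d) (int n)"
    by (metis gcd.commute gcd_red_int)
  also have "\<dots> = int d"
    using assms(2) by (metis gcd_int_int_eq gcd_nat.absorb1)
  finally show ?thesis
    using that[of "int d mod int n"] assms(1) by (simp add: gcd_label_def)
qed

text \<open>The multiples of \<open>u\<close> modulo \<open>n\<close> are the residues divisible by
  the gcd of \<open>u\<close> and \<open>n\<close>, by solvability of linear congruences.\<close>

lemma multiple_mod_iff_gcd_label_dvd:
  assumes "n > 0" "v \<in> {0..<int n}"
  shows "(\<exists>m>0. v = (int m * u) mod int n) \<longleftrightarrow> gcd_label n u dvd gcd_label n v"
proof -
  have "gcd_label n u dvd gcd_label n v \<longleftrightarrow> gcd u (int n) dvd v"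
    by (simp add: gcd_label_def nat_dvd_iff)
  moreover have "gcd u (int n) dvd v" if "v = (int m * u) mod int n" for m
    unfolding that by (intro dvd_mod) auto
  moreover have "\<exists>m>0. v = (int m * u) mod int n" if dvd: "gcd u (int n) dvd v"
  proof -
    obtain x where "[u * x = v] (mod int n)"
      using cong_solve_dvd_int[OF dvd] by blast
    then have x: "(x * u) mod int n = v"
      using assms by (simp add: cong_def mult.commute)
    \<comment> \<open>The solution \<open>x\<close> may be negative or divisible by
      \<open>n\<close>; reducing it and adding \<open>n\<close> gives a positive exponent with the
      same effect.\<close>
    define m where "m = nat (x mod int n) + n"
    have "int m = x mod int n + int n"
      using assms(1) by (simp add: m_def)
    then have "(int m * u) mod int n = v"
      using x by (simp add: mod_mult_left_eq distrib_right)
    then show ?thesis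
      using assms(1) by (intro exI[of _ m]) (auto simp: m_def)
  qed
  ultimately show ?thesis by blast
qed

lemma pverts_power_graph_mod:
  assumes "n > 0"
  shows "pverts (power_graph (integer_mod_group n)) = {0..<int n}"
  using assms by (simp add: power_graph_def carrier_integer_mod_group)

lemma parcs_power_graph_mod:
  assumes "n > 0" "u \<in> {0..<int n}" "v \<in> {0..<int n}" "u \<noteq> v"
  shows "(u, v) \<in> parcs (power_graph (integer_mod_group n)) \<longleftrightarrow>
    \<not> dvd_incomparable (gcd_label n u) (gcd_label n v)"
  using assms multiple_mod_iff_gcd_label_dvd[OF assms(1,2), of v]
    multiple_mod_iff_gcd_label_dvd[OF assms(1,3), of u]
  by (auto simp: power_graph_def carrier_integer_mod_group dvd_incomparable_def)

theorem theorem3p5: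
  fixes n :: nat
  assumes "n > 1"
  shows "real (vertex_connectivity (power_graph (integer_mod_group n))) =
           laplacian_eigenvalue (power_graph (integer_mod_group n)) (n - 1) \<longleftrightarrow>
         (\<exists>p q :: nat. prime p \<and> prime q \<and> p \<noteq> q \<and> n = p * q)"
proof -
  define G where "G = power_graph (integer_mod_group n)"
  have n: "n > 0" using assms by simp
  note V = pverts_power_graph_mod[OF n, folded G_def]
  note E = parcs_power_graph_mod[OF n, folded G_def]
  have "pair_graph G"
    unfolding G_def using n by (intro pair_graph_power_graph) (simp add: carrier_integer_mod_group)
  then interpret pair_graph G .
  interpret linorder_pair_graph G ..
  have card_V: "card (pverts G) = n"
    by (simp add: V)
  let ?ac = "laplacian_eigenvalue (with_proj G) (n - 1)" and ?\<kappa> = "vertex_connectivity (with_proj G)"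
  have ne: "pverts G \<noteq> {}"
    using n by (simp add: V)
  have ge: "card D \<le> ?ac" if "D \<subseteq> pverts G"
    "\<And>d v. d \<in> D \<Longrightarrow> v \<in> pverts G \<Longrightarrow> d \<noteq> v \<Longrightarrow> (d, v) \<in> parcs G" for D
    using algebraic_connectivity_ge_dominating[of D] that assms by (simp add: card_V)
  have "?\<kappa> = ?ac \<longleftrightarrow> (\<exists>p q :: nat. prime p \<and> prime q \<and> p \<noteq> q \<and> n = p * q)"
  proof
    assume eq: "?\<kappa> = ?ac"
    show "\<exists>p q :: nat. prime p \<and> prime q \<and> p \<noteq> q \<and> n = p * q"
    proof (cases rule: vertex_connectivity_cases[OF ne, case_names complete cut])
      case complete
      \<comment> \<open>Every vertex is dominating, so the algebraic connectivity is at least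
        \<open>n\<close>, which exceeds the vertex connectivity.\<close>
      then show ?thesis
        using ge[of "pverts G"] eq by (simp add: card_V)
    next
      case (cut A B)
      \<comment> \<open>Equality in the cut bound makes every cut vertex adjacent to all of
        \<open>A \<union> B\<close>. So a vertex not adjacent to some other vertex of
        \<open>A \<union> B\<close> lies in it too, which is the closure property required of the
        labels.\<close>
      note adj = algebraic_connectivity_cut(2)[OF cut(1), unfolded card_V cut(2)[symmetric], OF eq[symmetric]]
      have AB: "A \<subseteq> {0..<int n}" "B \<subseteq> {0..<int n}" "A \<noteq> {}" "B \<noteq> {}" "A \<inter> B = {}"
        "\<And>a b. a \<in> A \<Longrightarrow> b \<in> B \<Longrightarrow> (a, b) \<notin> parcs G"
        using cut(1) by (auto simp: separated_def V)
      show ?thesis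
      proof (rule two_incomparable_classes[OF n, of "gcd_label n ` A" "gcd_label n ` B"])
        fix a w assume "a \<in> gcd_label n ` A \<union> gcd_label n ` B" and w: "w dvd n" "dvd_incomparable a w"
        then obtain v where v: "v \<in> A \<union> B" "a = gcd_label n v"
          by blast
        obtain u where u: "u \<in> {0..<int n}" "gcd_label n u = w"
          using gcd_label_surj[OF n w(1)] by blast
        have "u \<noteq> v"
          using w(2) u(2) v(2) by (auto simp: dvd_incomparable_def)
        moreover have "v \<in> {0..<int n}"
          using v(1) AB by blast
        ultimately have "(u, v) \<notin> parcs G"
          using E[of u v] u v w(2) dvd_incomparable_sym by blast
        then have "u \<in> A \<union> B"
          using adj[of u v] u(1) v(1) unfolding V by blast
        then show "w \<in> gcd_label n ` A \<union> gcd_label n ` B"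
          using u(2) by blast
      next
        fix a b assume "a \<in> gcd_label n ` A" "b \<in> gcd_label n ` B"
        then obtain x y where xy: "x \<in> A" "y \<in> B" "a = gcd_label n x" "b = gcd_label n y"
          by blast
        then show "dvd_incomparable a b"
          using E[of x y] AB(1,2,5,6) by blast
      qed (use AB gcd_label_dvd in auto)
    qed
  next
    assume "\<exists>p q :: nat. prime p \<and> prime q \<and> p \<noteq> q \<and> n = p * q"
    then obtain p q where pq: "prime p" "prime q" "p \<noteq> q" "n = p * q" by blast
    have inc: "dvd_incomparable p q"
      using pq primes_dvd_imp_eq unfolding dvd_incomparable_def by blast
    define A B D where "A = {u \<in> pverts G. gcd_label n u = p}"
      and "B = {u \<in> pverts G. gcd_label n u = q}"
      and "D = {u \<in> pverts G. gcd_label n u \<in> {1, n}}"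
    have lab: "gcd_label n u \<in> {1, p, q, n}" for u
    proof -
      obtain a b where "gcd_label n u = a * b" "a dvd p" "b dvd q"
        using division_decomp[of "gcd_label n u" p q] gcd_label_dvd[of n u] pq(4) by metis
      moreover from this have "a = 1 \<or> a = p" "b = 1 \<or> b = q"
        using pq(1,2) unfolding prime_nat_iff by blast+
      ultimately show ?thesis
        using pq(4) by auto
    qed
    have "p \<noteq> 1" "q \<noteq> 1" "p \<noteq> n" "q \<noteq> n"
      using pq by auto
    then have D: "pverts G - (A \<union> B) = D"
      using lab by (auto simp: A_def B_def D_def)
    have "p dvd n" "q dvd n"
      using pq(4) by simp_all
    obtain a b where "a \<in> {0..<int n}" "gcd_label n a = p" "b \<in> {0..<int n}" "gcd_label n b = q"
      by (rule gcd_label_surj[OF n \<open>p dvd n\<close>], rule gcd_label_surj[OF n \<open>q dvd n\<close>])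
    then have ab: "a \<in> A" "b \<in> B"
      by (simp_all add: A_def B_def V)
    have "(x, y) \<notin> parcs G" if "x \<in> A" "y \<in> B" for x y
      using that E[of x y] inc pq(3) unfolding A_def B_def V by auto
    then have sep: "separated A B"
      using ab pq(3) unfolding separated_def A_def B_def by blast
    \<comment> \<open>The chain \<open>?\<kappa> \<le> card D \<le> ?ac \<le> ?\<kappa>\<close>
      gives equality. Its last link uses a minimum cut, which exists because the separation of
      \<open>A\<close> and \<open>B\<close> rules out a complete graph.\<close>
    have "?\<kappa> \<le> card D"
      using vertex_connectivity_le[OF sep] by (simp add: D)
    moreover have "card D \<le> ?ac"
    proof (rule ge)
      fix d v assume "d \<in> D" "v \<in> pverts G" "d \<noteq> v"
      then show "(d, v) \<in> parcs G"
        using E[of d v] gcd_label_dvd[of n v] unfolding D_def V by (auto simp: dvd_incomparable_def)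
    qed (auto simp: D_def)
    moreover have "?ac \<le> ?\<kappa>"
    proof (cases rule: vertex_connectivity_cases[OF ne, case_names complete cut])
      case complete
      then show ?thesis
        using sep unfolding separated_def by (metis disjoint_iff in_mono all_not_in_conv)
    next
      case (cut A' B')
      then show ?thesis
        using algebraic_connectivity_cut(1)[OF cut(1)] by (simp add: card_V)
    qed
    ultimately show "?\<kappa> = ?ac"
      by simp
  qed
  then show ?thesis
    unfolding G_def .
qed

end
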